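(* Let $\lambda\in\mathbb{R}$, $\lambda\neq 0$, and let $X_1\sim SN(\lambda)$ be a univariate skew normal random variable with cumulative distribution function $F_1$ and quantile function $F_1^{-1}$. Then, as $u\to 0^+$, $F_1^{-1}(u)\sim y(u)$, where $$ y(u)=\begin{cases} -\sqrt{-\dfrac{2}{1+\lambda^2}\,\log\bigl(-2\pi\lambda u\,\log(2\pi\lambda u)\bigr)}, & \text{if }\lambda>0,\\[2ex] -\sqrt{-2\log\left(\dfrac{u}{2}\sqrt{-4\pi\log\left(\dfrac{u}{2}\sqrt{2\pi}\right)}\right)}, & \text{if }\lambda<0. \end{cases} $$
   Context: $X_1\sim SN(\lambda)$ means that $X_1$ has probability density $f_{X_1}(x)=2\phi(x)\Phi(\lambda x)$, $x\in\mathbb{R}$, where $\phi$ and $\Phi$ are the density and cumulative distribution function of the standard normal distribution. $F_1(z)=P(X_1\le z)$ and $F_1^{-1}$ is its inverse function on $(0,1)$. The notation $f(u)\sim g(u)$ as $u\to 0^+$ means $f(u)/g(u)\to 1$ as $u\to 0^+$. The function $y(u)$ is considered for all sufficiently small $u>0$, where it is well defined. *)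

theory Defs
  imports "HOL-Probability.Probability"
begin

definition skew_normal_density :: "real \<Rightarrow> real \<Rightarrow> real" where
  "skew_normal_density lam x =
     2 * std_normal_density x * cdf std_normal_distribution (lam * x)"

text \<open>
  The inverse function of the distribution function is meant on the open unit interval;
  outside the range of the distribution function the value is arbitrary.
\<close>

definition quantile :: "real measure \<Rightarrow> real \<Rightarrow> real" where
  "quantile D u = inv (cdf D) u"

text \<open>
  The real square root and logarithm are total functions in HOL. For all sufficiently small
  positive \<open>u\<close> their arguments below lie in the proper domains, and only such \<open>u\<close> matter
  for a limit at \<open>0\<close> from the right.
\<close>

definition skew_normal_quantile_approx :: "real \<Rightarrow> real \<Rightarrow> real" where
  "skew_normal_quantile_approx lam u =
     (if lam > 0
      then - sqrt (- (2 / (1 + lam\<^sup>2)) * ln (- (2 * pi * lam * u * ln (2 * pi * lam * u))))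
      else - sqrt (- 2 * ln (u / 2 * sqrt (- 4 * pi * ln (u / 2 * sqrt (2 * pi))))))"

end

theory Submission
  imports Defs "HOL-Real_Asymp.Real_Asymp"
begin

text \<open>
  Both the quantile and its approximation have the form \<open>- sqrt (- a * ln u * (1 + o(1)))\<close>
  with \<open>a > 0\<close>, and their quotient tends to \<open>1\<close> as soon as the constants \<open>a\<close> agree. For the
  quantile this constant is the reciprocal of the rate at which the logarithm of the
  distribution function \<open>F\<close> decays in terms of \<open>x\<^sup>2\<close>, so crude estimates of \<open>F\<close> suffice.

  Put \<open>\<kappa> = max 0 \<lambda>\<close> and \<open>c = 1 + \<kappa>\<^sup>2\<close>. The factor \<open>\<Phi> (\<lambda> t)\<close> of the density behaves, as
  \<open>t\<close> goes to minus infinity, like \<open>exp (- \<kappa>\<^sup>2 t\<^sup>2 / 2)\<close> on the logarithmic scale: for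
  \<open>\<lambda> > 0\<close> it is a Gaussian tail, and for \<open>\<lambda> < 0\<close> it stays between \<open>\<Phi> 0\<close> and \<open>1\<close>. This
  gives bounds on both sides of \<open>F\<close> (lemmas \<open>skew_normal_cdf_upper\<close> and
  \<open>skew_normal_cdf_lower\<close>) that agree to leading logarithmic order, whence
  \<open>ln (F x) / x\<^sup>2 \<longlonglongrightarrow> - c / 2\<close> as \<open>x\<close> goes to minus infinity
  (\<open>skew_normal_ln_cdf_asymp\<close>).

  Since \<open>F\<close> is continuous, the quantile \<open>q u\<close> satisfies \<open>F (q u) = u\<close>, and it tends to minus
  infinity as \<open>u\<close> tends to \<open>0\<close>. Substituting \<open>x = q u\<close> yields \<open>(q u)\<^sup>2 / ln u \<longlonglongrightarrow> - 2 / c\<close>.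
  The explicit approximation has the same limit
  (\<open>skew_normal_quantile_approx_square_asymp\<close>), because its outer logarithm differs from
  \<open>ln u\<close> only by a term of order \<open>ln (ln (1 / u))\<close>. Hence the squared quotient tends to \<open>1\<close>, and
  the quotient itself does because both functions are eventually negative.
\<close>

section \<open>Crude bounds for Gaussian-type tails\<close>

text \<open>
  For \<open>t \<le> x \<le> 0\<close> one has \<open>t\<^sup>2 \<ge> x\<^sup>2 + (t - x)\<^sup>2\<close>, so the standard normal density at \<open>t\<close> is
  at most \<open>exp (- x\<^sup>2 / 2)\<close> times the normal density centred at \<open>x\<close>, whose total mass is \<open>1\<close>.
\<close>

lemma gaussian_dominated_tail_upper:
  fixes f :: "real \<Rightarrow> real"
  assumes f[measurable]: "f \<in> borel_measurable borel"
    and le: "\<And>t. t \<le> x \<Longrightarrow> f t \<le> C * std_normal_density t"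
    and x: "x \<le> 0" and C: "0 \<le> C"
  shows "measure (density lborel f) {..x} \<le> C * exp (- x\<^sup>2 / 2)"
proof -
  define K where "K = C * exp (- x\<^sup>2 / 2)"
  have K: "0 \<le> K" using C by (simp add: K_def)
  have pointwise: "f t \<le> K * normal_density x 1 t" if t: "t \<le> x" for t
  proof -
    have "x * (x - t) \<le> 0"
      using x t by (simp add: mult_nonpos_nonneg)
    hence "- t\<^sup>2 / 2 \<le> - x\<^sup>2 / 2 + - (t - x)\<^sup>2 / 2"
      by (simp add: power2_eq_square algebra_simps)
    hence "exp (- t\<^sup>2 / 2) \<le> exp (- x\<^sup>2 / 2) * exp (- (t - x)\<^sup>2 / 2)"
      by (simp flip: exp_add)
    hence "std_normal_density t \<le> exp (- x\<^sup>2 / 2) * normal_density x 1 t"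
      by (simp add: normal_density_def divide_right_mono)
    hence "C * std_normal_density t \<le> C * (exp (- x\<^sup>2 / 2) * normal_density x 1 t)"
      using C by (rule mult_left_mono)
    with le[OF t] show ?thesis by (simp add: K_def)
  qed
  interpret N: prob_space "density lborel (normal_density x 1)"
    by (rule prob_space_normal_density) simp
  have mass: "(\<integral>\<^sup>+ t. ennreal (normal_density x 1 t) \<partial>lborel) = 1"
    using N.emeasure_space_1 by (simp add: emeasure_density)
  have "emeasure (density lborel f) {..x} = (\<integral>\<^sup>+ t. ennreal (f t) * indicator {..x} t \<partial>lborel)"
    by (simp add: emeasure_density)
  also have "\<dots> \<le> (\<integral>\<^sup>+ t. ennreal K * ennreal (normal_density x 1 t) \<partial>lborel)"
    using pointwise K
    by (intro nn_integral_mono) (auto simp: indicator_def ennreal_mult[symmetric] intro!: ennreal_leI)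
  also have "\<dots> = ennreal K"
    by (simp add: nn_integral_cmult mass)
  finally show ?thesis
    using K by (simp add: measure_def K_def enn2real_leI)
qed

lemma measure_tail_ge_density_lower_bound:
  fixes f :: "real \<Rightarrow> real"
  assumes [measurable]: "f \<in> borel_measurable borel"
    and fin: "finite_measure (density lborel f)"
    and ge: "\<And>t. x - 1 \<le> t \<Longrightarrow> t \<le> x \<Longrightarrow> c \<le> f t"
  shows "c \<le> measure (density lborel f) {..x}"
proof -
  interpret finite_measure "density lborel f" by (rule fin)
  have "ennreal c = (\<integral>\<^sup>+ t. ennreal c * indicator {x - 1..x} t \<partial>lborel)"
    by (simp add: nn_integral_cmult_indicator)
  also have "\<dots> \<le> (\<integral>\<^sup>+ t. ennreal (f t) * indicator {..x} t \<partial>lborel)"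
    using ge by (intro nn_integral_mono) (auto simp: indicator_def intro!: ennreal_leI)
  also have "\<dots> = emeasure (density lborel f) {..x}"
    by (simp add: emeasure_density)
  also have "\<dots> = ennreal (measure (density lborel f) {..x})"
    by (rule emeasure_eq_measure)
  finally show ?thesis by simp
qed

lemma std_normal_density_mono_nonpos:
  assumes "s \<le> t" "t \<le> 0"
  shows "std_normal_density s \<le> std_normal_density t"
proof -
  have "t\<^sup>2 \<le> s\<^sup>2" using assms by (simp add: abs_le_square_iff[symmetric])
  thus ?thesis by (simp add: normal_density_def divide_right_mono)
qed

section \<open>The tail of the skew normal distribution\<close>

abbreviation std_normal_cdf :: "real \<Rightarrow> real" where
  "std_normal_cdf \<equiv> cdf std_normal_distribution"

lemma real_distribution_std_normal: "real_distribution std_normal_distribution"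
  by (simp add: real_distribution_def real_distribution_axioms_def prob_space_normal_density)

lemma std_normal_cdf_mono: "x \<le> y \<Longrightarrow> std_normal_cdf x \<le> std_normal_cdf y"
  using real_distribution_std_normal
  by (intro finite_borel_measure.cdf_nondecreasing real_distribution.finite_borel_measure_M)

lemma std_normal_cdf_le_1: "std_normal_cdf x \<le> 1"
  using real_distribution_std_normal by (rule real_distribution.cdf_bounded_prob)

lemma std_normal_cdf_upper: "x \<le> 0 \<Longrightarrow> std_normal_cdf x \<le> exp (- x\<^sup>2 / 2)"
  using gaussian_dominated_tail_upper[of std_normal_density x 1] by (simp add: cdf_def)

lemma std_normal_cdf_lower:
  assumes "x \<le> 0"
  shows "std_normal_density (x - 1) \<le> std_normal_cdf x"
  unfolding cdf_def
proof (rule measure_tail_ge_density_lower_bound)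
  show "finite_measure std_normal_distribution"
    by (rule prob_space.finite_measure) (simp add: prob_space_normal_density)
qed (use assms in \<open>auto intro!: std_normal_density_mono_nonpos\<close>)

lemma skew_normal_density_measurable [measurable]:
  "skew_normal_density lam \<in> borel_measurable borel"
proof -
  have [measurable]: "std_normal_cdf \<in> borel_measurable borel"
    by (rule borel_measurable_mono) (auto intro: monoI std_normal_cdf_mono)
  show ?thesis unfolding skew_normal_density_def[abs_def] by measurable
qed

text \<open>
  By monotonicity of \<open>\<Phi>\<close>, the factor \<open>\<Phi> (\<lambda> t)\<close> is at most its Gaussian bound at the endpoint
  \<open>x\<close>, so it can be pulled out of the integral over \<open>t \<le> x\<close>. Taking \<open>\<kappa> = max 0 \<lambda>\<close> covers both
  signs of \<open>\<lambda>\<close>: for \<open>\<kappa> = 0\<close> the bound on the factor is the trivial bound \<open>1\<close>.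
\<close>

lemma skew_normal_cdf_upper:
  assumes x: "x \<le> 0"
  shows "cdf (density lborel (skew_normal_density lam)) x
           \<le> 2 * exp (- ((1 + (max 0 lam)\<^sup>2) * x\<^sup>2 / 2))"
proof -
  define \<kappa> where "\<kappa> = max 0 lam"
  have factor: "std_normal_cdf (lam * t) \<le> exp (- (\<kappa> * x)\<^sup>2 / 2)" if t: "t \<le> x" for t
  proof (cases "lam > 0")
    case True
    have "std_normal_cdf (lam * t) \<le> std_normal_cdf (lam * x)"
      using True t by (intro std_normal_cdf_mono) simp
    also have "\<dots> \<le> exp (- (lam * x)\<^sup>2 / 2)"
      using True x by (intro std_normal_cdf_upper) (simp add: mult_nonneg_nonpos)
    finally show ?thesis using True by (simp add: \<kappa>_def)
  next
    case False
    thus ?thesis using std_normal_cdf_le_1 by (simp add: \<kappa>_def)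
  qed
  have "skew_normal_density lam t \<le> 2 * exp (- (\<kappa> * x)\<^sup>2 / 2) * std_normal_density t"
    if "t \<le> x" for t
    using mult_left_mono[OF factor[OF that], of "2 * std_normal_density t"]
    by (simp add: skew_normal_density_def mult_ac)
  hence "cdf (density lborel (skew_normal_density lam)) x
           \<le> 2 * exp (- (\<kappa> * x)\<^sup>2 / 2) * exp (- x\<^sup>2 / 2)"
    unfolding cdf_def using x by (intro gaussian_dominated_tail_upper) auto
  also have "\<dots> = 2 * exp (- ((1 + \<kappa>\<^sup>2) * x\<^sup>2 / 2))"
    by (simp add: power_mult_distrib field_simps flip: exp_add)
  finally show ?thesis by (simp add: \<kappa>_def)
qed

text \<open>
  The mass of \<open>[x - 1, x]\<close> alone is large enough. On this interval the normal density is smallest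
  at \<open>x - 1\<close>, and \<open>\<Phi> (\<lambda> t) \<ge> \<Phi> (\<kappa> t) \<ge> \<Phi> (\<kappa> (x - 1))\<close> for \<open>\<kappa> = max 0 \<lambda>\<close>, because
  \<open>t \<le> 0\<close>; the second shift by \<open>1\<close> comes from bounding this value of \<open>\<Phi>\<close> in the same way.
\<close>

lemma skew_normal_cdf_lower:
  assumes fin: "finite_measure (density lborel (skew_normal_density lam))"
    and x: "x \<le> 0"
  shows "2 * std_normal_density (x - 1) * std_normal_density (max 0 lam * (x - 1) - 1)
           \<le> cdf (density lborel (skew_normal_density lam)) x"
  unfolding cdf_def
proof (rule measure_tail_ge_density_lower_bound[OF _ fin])
  fix t assume t: "x - 1 \<le> t" "t \<le> x"
  define \<kappa> where "\<kappa> = max 0 lam"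
  have "\<kappa> * (x - 1) \<le> \<kappa> * t"
    using t by (intro mult_left_mono) (auto simp: \<kappa>_def)
  also have "\<dots> \<le> lam * t"
    using t x by (intro mult_right_mono_neg) (auto simp: \<kappa>_def)
  finally have "std_normal_cdf (\<kappa> * (x - 1)) \<le> std_normal_cdf (lam * t)"
    by (rule std_normal_cdf_mono)
  moreover have "std_normal_density (\<kappa> * (x - 1) - 1) \<le> std_normal_cdf (\<kappa> * (x - 1))"
    using x by (intro std_normal_cdf_lower) (auto simp: \<kappa>_def mult_nonneg_nonpos)
  moreover have "std_normal_density (x - 1) \<le> std_normal_density t"
    using t x by (intro std_normal_density_mono_nonpos) auto
  ultimately have "2 * std_normal_density (x - 1) * std_normal_density (\<kappa> * (x - 1) - 1)
      \<le> 2 * std_normal_density t * std_normal_cdf (lam * t)"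
    by (intro mult_mono) auto
  thus "2 * std_normal_density (x - 1) * std_normal_density (max 0 lam * (x - 1) - 1)
      \<le> skew_normal_density lam t"
    by (simp add: skew_normal_density_def \<kappa>_def)
qed simp

lemma ln_std_normal_density: "ln (std_normal_density x) = - x\<^sup>2 / 2 - ln (sqrt (2 * pi))"
  by (simp add: normal_density_def ln_div)

text \<open>
  The shifts by \<open>1\<close> in the lower bound change its logarithm only by a term linear in \<open>x\<close>, so
  both bounds give the same rate.
\<close>

lemma skew_normal_ln_cdf_asymp:
  assumes fin: "finite_measure (density lborel (skew_normal_density lam))"
  shows "((\<lambda>x. ln (cdf (density lborel (skew_normal_density lam)) x) / x\<^sup>2)
            \<longlongrightarrow> - (1 + (max 0 lam)\<^sup>2) / 2) at_bot"
proof (rule tendsto_sandwich)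
  define \<kappa> where "\<kappa> = max 0 lam"
  let ?F = "cdf (density lborel (skew_normal_density lam))"
  let ?l = "\<lambda>x. (ln 2 + (- (x - 1)\<^sup>2 / 2 - ln (sqrt (2 * pi)))
                  + (- (\<kappa> * (x - 1) - 1)\<^sup>2 / 2 - ln (sqrt (2 * pi)))) / x\<^sup>2"
  let ?u = "\<lambda>x. (ln 2 - (1 + \<kappa>\<^sup>2) * x\<^sup>2 / 2) / x\<^sup>2"
  have \<kappa>: "\<kappa> \<ge> 0" by (simp add: \<kappa>_def)
  have low: "2 * std_normal_density (x - 1) * std_normal_density (\<kappa> * (x - 1) - 1) \<le> ?F x"
    if "x \<le> 0" for x
    using skew_normal_cdf_lower[OF fin that] by (simp add: \<kappa>_def)
  have low_pos: "2 * std_normal_density (x - 1) * std_normal_density (\<kappa> * (x - 1) - 1) > 0" for x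
    by (simp add: normal_density_pos)
  show "\<forall>\<^sub>F x in at_bot. ?l x \<le> ln (?F x) / x\<^sup>2"
    using eventually_le_at_bot[of "0 :: real"]
  proof eventually_elim
    case (elim x)
    have "ln (2 * std_normal_density (x - 1) * std_normal_density (\<kappa> * (x - 1) - 1)) \<le> ln (?F x)"
      using low[OF elim] low_pos[of x] by simp
    also have "ln (2 * std_normal_density (x - 1) * std_normal_density (\<kappa> * (x - 1) - 1))
        = ln 2 + ln (std_normal_density (x - 1)) + ln (std_normal_density (\<kappa> * (x - 1) - 1))"
      using normal_density_pos[of 1 0] by (simp add: ln_mult less_imp_neq[symmetric])
    finally show ?case
      by (simp only: ln_std_normal_density) (intro divide_right_mono, auto)
  qed
  show "\<forall>\<^sub>F x in at_bot. ln (?F x) / x\<^sup>2 \<le> ?u x"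
    using eventually_le_at_bot[of "0 :: real"]
  proof eventually_elim
    case (elim x)
    have "ln (?F x) \<le> ln (2 * exp (- ((1 + \<kappa>\<^sup>2) * x\<^sup>2 / 2)))"
      using low[OF elim] low_pos[of x] skew_normal_cdf_upper[OF elim, of lam]
      by (subst ln_le_cancel_iff) (auto simp: \<kappa>_def simp del: ln_le_cancel_iff)
    also have "\<dots> = ln 2 - (1 + \<kappa>\<^sup>2) * x\<^sup>2 / 2"
      by (subst ln_mult) auto
    finally show ?case by (intro divide_right_mono) auto
  qed
  have inv: "(inverse \<longlongrightarrow> (0 :: real)) at_bot"
    using tendsto_inverse_0 at_bot_le_at_infinity by (rule tendsto_mono[rotated])
  have quadratic: "((\<lambda>x. (k + b * x - a * x\<^sup>2) / x\<^sup>2) \<longlongrightarrow> - a) at_bot" for a b k :: real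
  proof (rule Lim_transform_eventually)
    show "((\<lambda>x. k * (inverse x)\<^sup>2 + b * inverse x - a) \<longlongrightarrow> - a) at_bot"
      by (rule tendsto_eq_intros inv refl | simp)+
    show "\<forall>\<^sub>F x in at_bot. k * (inverse x)\<^sup>2 + b * inverse x - a = (k + b * x - a * x\<^sup>2) / x\<^sup>2"
      using eventually_gt_at_bot[of "0 :: real"]
      by eventually_elim (simp add: field_simps power2_eq_square)
  qed
  \<comment> \<open>Expanding the squares shows the leading coefficient.\<close>
  have l_eq: "?l = (\<lambda>x. ((ln 2 - 2 * ln (sqrt (2 * pi)) - 1 / 2 - (\<kappa> + 1)\<^sup>2 / 2)
                 + (1 + \<kappa> + \<kappa>\<^sup>2) * x - (1 + \<kappa>\<^sup>2) / 2 * x\<^sup>2) / x\<^sup>2)"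
    by (intro ext arg_cong2[where f = "(/)"] refl)
       (simp add: field_simps power2_eq_square)
  show "(?l \<longlongrightarrow> - (1 + (max 0 lam)\<^sup>2) / 2) at_bot"
    unfolding l_eq \<kappa>_def[symmetric] using quadratic[of _ _ "(1 + \<kappa>\<^sup>2) / 2"]
    by (simp only: minus_divide_left)
  show "(?u \<longlongrightarrow> - (1 + (max 0 lam)\<^sup>2) / 2) at_bot"
    unfolding \<kappa>_def[symmetric] using quadratic[of "ln 2" 0 "(1 + \<kappa>\<^sup>2) / 2"]
    by (subst minus_divide_left[symmetric]) simp
qed

section \<open>Quantiles near zero\<close>

lemma cdf_quantile:
  assumes D: "real_distribution D"
    and cont: "\<And>x. isCont (cdf D) x"
    and u: "0 < u" "u < 1"
  shows "cdf D (quantile D u) = u"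
proof -
  interpret real_distribution D by (rule D)
  have "\<forall>\<^sub>F x in at_bot. cdf D x < u"
    using cdf_lim_at_bot u(1) by (rule order_tendstoD(2))
  then obtain a where a: "\<And>x. x \<le> a \<Longrightarrow> cdf D x < u"
    by (auto simp: eventually_at_bot_linorder)
  have "\<forall>\<^sub>F x in at_top. cdf D x > u"
    using cdf_lim_at_top_prob u(2) by (rule order_tendstoD(1))
  then obtain b where b: "\<And>x. x \<ge> b \<Longrightarrow> cdf D x > u"
    by (auto simp: eventually_at_top_linorder)
  have "\<exists>x\<ge>min a b. x \<le> max a b \<and> cdf D x = u"
    using a[of "min a b"] b[of "max a b"] cont by (intro IVT) (auto simp: less_imp_le)
  hence "u \<in> range (cdf D)" by auto
  thus ?thesis by (simp add: quantile_def f_inv_into_f)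
qed

lemma quantile_at_bot:
  assumes D: "real_distribution D"
    and cont: "\<And>x. isCont (cdf D) x"
    and pos: "\<And>x. x \<le> 0 \<Longrightarrow> cdf D x > 0"
  shows "filterlim (quantile D) at_bot (at_right 0)"
proof (subst filterlim_at_bot_le[where c = 0], intro allI impI)
  interpret real_distribution D by (rule D)
  fix Z :: real assume "Z \<le> 0"
  hence "\<forall>\<^sub>F u in at_right 0. u \<in> {0<..<min 1 (cdf D Z)}"
    using pos by (intro eventually_at_right_real) auto
  thus "\<forall>\<^sub>F u in at_right 0. quantile D u \<le> Z"
  proof eventually_elim
    case (elim u)
    hence "cdf D (quantile D u) < cdf D Z"
      using cdf_quantile[OF D cont] by simp
    thus ?case using cdf_nondecreasing[of Z "quantile D u"] by force
  qed
qed

text \<open>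
  For \<open>\<lambda> > 0\<close> the expression under the root is \<open>- 2 / (1 + \<lambda>\<^sup>2)\<close> times
  \<open>ln u + ln (- ln u)\<close> up to a bounded term, and for \<open>\<lambda> < 0\<close> it is \<open>- 2\<close> times
  \<open>ln u + ln (- ln u) / 2\<close> up to a bounded term.
\<close>

lemma skew_normal_quantile_approx_square_asymp:
  assumes "lam \<noteq> 0"
  shows "((\<lambda>u. (skew_normal_quantile_approx lam u)\<^sup>2 / ln u)
            \<longlongrightarrow> - 2 / (1 + (max 0 lam)\<^sup>2)) (at_right 0)"
    and "\<forall>\<^sub>F u in at_right 0. skew_normal_quantile_approx lam u < 0"
proof -
  define A where "A u =
    (if lam > 0 then - (2 / (1 + lam\<^sup>2)) * ln (- (2 * pi * lam * u * ln (2 * pi * lam * u)))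
     else - 2 * ln (u / 2 * sqrt (- 4 * pi * ln (u / 2 * sqrt (2 * pi)))))" for u
  have approx: "skew_normal_quantile_approx lam u = - sqrt (A u)" for u
    by (simp add: skew_normal_quantile_approx_def A_def)
  have "filterlim A at_top (at_right 0) \<and>
        ((\<lambda>u. A u / ln u) \<longlongrightarrow> - 2 / (1 + (max 0 lam)\<^sup>2)) (at_right 0)"
  proof (cases "lam > 0")
    case True
    define d where "d = 1 + lam\<^sup>2"
    have d: "d > 0" by (simp add: d_def add_pos_nonneg)
    have "filterlim (\<lambda>u. - (2 / d) * ln (- (2 * pi * lam * u * ln (2 * pi * lam * u))))
            at_top (at_right 0)"
      using True d by real_asymp
    moreover have "((\<lambda>u. - (2 / d) * ln (- (2 * pi * lam * u * ln (2 * pi * lam * u))) / ln u)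
            \<longlongrightarrow> - 2 / d) (at_right 0)"
      using True d by real_asymp
    ultimately show ?thesis using True by (simp add: A_def[abs_def] d_def)
  next
    case False
    have "filterlim (\<lambda>u::real. - 2 * ln (u / 2 * sqrt (- 4 * pi * ln (u / 2 * sqrt (2 * pi)))))
            at_top (at_right 0)"
      by real_asymp
    moreover have "((\<lambda>u::real. - 2 * ln (u / 2 * sqrt (- 4 * pi * ln (u / 2 * sqrt (2 * pi)))) / ln u)
            \<longlongrightarrow> - 2) (at_right 0)"
      by real_asymp
    ultimately show ?thesis using False by (simp add: A_def[abs_def])
  qed
  hence lim: "((\<lambda>u. A u / ln u) \<longlongrightarrow> - 2 / (1 + (max 0 lam)\<^sup>2)) (at_right 0)"
    and pos: "\<forall>\<^sub>F u in at_right 0. A u > 0"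
    by (auto simp: filterlim_at_top_dense)
  show "\<forall>\<^sub>F u in at_right 0. skew_normal_quantile_approx lam u < 0"
    using pos by eventually_elim (simp add: approx)
  have "\<forall>\<^sub>F u in at_right 0. A u / ln u = (skew_normal_quantile_approx lam u)\<^sup>2 / ln u"
    using pos by eventually_elim (simp add: approx)
  with lim show "((\<lambda>u. (skew_normal_quantile_approx lam u)\<^sup>2 / ln u)
            \<longlongrightarrow> - 2 / (1 + (max 0 lam)\<^sup>2)) (at_right 0)"
    by (rule Lim_transform_eventually)
qed

theorem theorem1:
  fixes M :: "'a measure" and X :: "'a \<Rightarrow> real" and lam :: real
  assumes "prob_space M"
    and "lam \<noteq> 0"
    and "distributed M lborel X (skew_normal_density lam)"
  shows "((\<lambda>u. quantile (distr M borel X) u / skew_normal_quantile_approx lam u) \<longlongrightarrow> 1)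
           (at_right 0)"
proof -
  define D where "D = distr M borel X"
  let ?q = "quantile D" and ?y = "skew_normal_quantile_approx lam"
  define c where "c = 1 + (max 0 lam)\<^sup>2"
  have c: "c > 0" by (simp add: c_def add_pos_nonneg)
  have X: "X \<in> borel_measurable M"
    using distributed_measurable[OF assms(3)] by simp
  have "distr M lborel X = density lborel (skew_normal_density lam)"
    using assms(3) by (rule distributed_distr_eq_density)
  moreover have "distr M borel X = distr M lborel X"
    by (rule distr_cong) auto
  ultimately have D_density: "D = density lborel (skew_normal_density lam)"
    by (simp add: D_def)
  have D: "real_distribution D"
    unfolding D_def using assms(1) X by (rule prob_space.real_distribution_distr)
  interpret D: real_distribution D by (rule D)
  have fin: "finite_measure (density lborel (skew_normal_density lam))"
    using D.finite_measure_axioms by (simp add: D_density)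
  have cont: "isCont (cdf D) x" for x
  proof -
    have "emeasure D {x} = 0"
      unfolding D_density by (simp add: emeasure_density nn_integral_null_set)
    thus ?thesis by (simp add: D.isCont_cdf measure_def)
  qed
  have pos: "cdf D x > 0" if "x \<le> 0" for x
  proof -
    have "0 < 2 * std_normal_density (x - 1) * std_normal_density (max 0 lam * (x - 1) - 1)"
      by (simp add: normal_density_pos)
    with skew_normal_cdf_lower[OF fin that] show ?thesis by (simp add: D_density)
  qed
  have q_bot: "filterlim ?q at_bot (at_right 0)"
    using D cont pos by (rule quantile_at_bot)
  have q_neg: "\<forall>\<^sub>F u in at_right 0. ?q u < 0"
    using q_bot by (simp add: filterlim_at_bot_dense)
  have y_neg: "\<forall>\<^sub>F u in at_right 0. ?y u < 0"
    using assms(2) by (rule skew_normal_quantile_approx_square_asymp)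
  have u01: "\<forall>\<^sub>F u in at_right 0. u \<in> {0<..<1 :: real}"
    by (rule eventually_at_right_real) simp

  have "((\<lambda>u. ln (cdf D (?q u)) / (?q u)\<^sup>2) \<longlongrightarrow> - c / 2) (at_right 0)"
    using filterlim_compose[OF skew_normal_ln_cdf_asymp[OF fin] q_bot]
    by (simp add: D_density c_def)
  moreover have "\<forall>\<^sub>F u in at_right 0. ln (cdf D (?q u)) / (?q u)\<^sup>2 = ln u / (?q u)\<^sup>2"
    using u01 by eventually_elim (simp add: cdf_quantile[OF D cont])
  ultimately have "((\<lambda>u. ln u / (?q u)\<^sup>2) \<longlongrightarrow> - c / 2) (at_right 0)"
    by (rule Lim_transform_eventually)
  moreover have "((\<lambda>u. (?y u)\<^sup>2 / ln u) \<longlongrightarrow> - 2 / c) (at_right 0)"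
    unfolding c_def using assms(2) by (rule skew_normal_quantile_approx_square_asymp)
  ultimately have "((\<lambda>u. (ln u / (?q u)\<^sup>2) * ((?y u)\<^sup>2 / ln u))
      \<longlongrightarrow> (- c / 2) * (- 2 / c)) (at_right 0)"
    by (rule tendsto_mult)
  hence "((\<lambda>u. 1 / sqrt ((ln u / (?q u)\<^sup>2) * ((?y u)\<^sup>2 / ln u)))
      \<longlongrightarrow> 1 / sqrt ((- c / 2) * (- 2 / c))) (at_right 0)"
    using c by (intro tendsto_divide tendsto_const tendsto_real_sqrt) auto
  moreover have "1 / sqrt ((- c / 2) * (- 2 / c)) = 1"
    using c by simp
  ultimately have "((\<lambda>u. 1 / sqrt ((ln u / (?q u)\<^sup>2) * ((?y u)\<^sup>2 / ln u))) \<longlongrightarrow> 1) (at_right 0)"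
    by (simp only:)
  moreover have "\<forall>\<^sub>F u in at_right 0.
      1 / sqrt ((ln u / (?q u)\<^sup>2) * ((?y u)\<^sup>2 / ln u)) = ?q u / ?y u"
    using u01 q_neg y_neg
  proof eventually_elim
    case (elim u)
    hence "(ln u / (?q u)\<^sup>2) * ((?y u)\<^sup>2 / ln u) = (?y u / ?q u)\<^sup>2"
      by (simp add: power_divide)
    moreover have "?y u / ?q u > 0"
      using elim by (simp add: divide_neg_neg)
    ultimately show ?case by (simp only: real_sqrt_abs abs_of_pos) simp
  qed
  ultimately show ?thesis
    unfolding D_def by (rule Lim_transform_eventually)
qed

end
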